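(* Let $K$ be a finite simplicial complex with nonempty vertex set and $s\ge1$. Then for every integer $r\ge1$ the number of $(r,s)$-colorings of $K$ is \[ \chi^s(K,r)=\sum_{T\in L^s(K)}\mu(\emptyset,T)\,r^{|\pi(T)|}, \] where $\mu$ is the Möbius function of the poset $L^s(K)$.
   Context: An $s$-simplex of $K$ is a face with $s+1$ vertices; $F^s(K)$ is the set of them. An $(r,s)$-coloring is a map $V(K)\to\{1,\dots,r\}$ with no monochrome $s$-simplex, and $\chi^s(K,r)$ is their number. For $S\subseteq F^s(K)$: the connected components of $S$ are the equivalence classes of the smallest equivalence relation on $S$ relating simplices with nonempty intersection; $V(S)=\bigcup S$; $S$ is closed if $\{\sigma\in F^s(K)\mid\sigma\subseteq V(S)\}=S$; $\pi(S)$ is the partition of $V(K)$ whose blocks are the vertex sets of the connected components of $S$ together with the singletons $\{v\}$, $v\in V(K)\setminus V(S)$. $L^s(K)$ is the set of subsets of $F^s(K)$ all of whose connected components are closed, ordered by inclusion (a lattice with least element $\emptyset$). *)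

theory Defs
  imports Main "HOL-Library.FuncSet"
begin

text \<open>Abstract simplicial complexes, given by their set of faces. Only nonempty subsets of
  faces are required to be faces, so both conventions for the empty face are admitted; every
  element of \<open>\<Union>K\<close> is automatically a vertex (\<open>{v} \<in> K\<close>).\<close>

definition simplicial_complex :: "'a set set \<Rightarrow> bool" where
  "simplicial_complex K \<longleftrightarrow>
     (\<forall>\<sigma>\<in>K. finite \<sigma> \<and> (\<forall>\<tau>. \<tau> \<subseteq> \<sigma> \<and> \<tau> \<noteq> {} \<longrightarrow> \<tau> \<in> K))"

definition vertices :: "'a set set \<Rightarrow> 'a set" where
  "vertices K = \<Union>K"

definition simplices :: "nat \<Rightarrow> 'a set set \<Rightarrow> 'a set set" where
  "simplices s K = {\<sigma> \<in> K. card \<sigma> = s + 1}"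

definition monochrome :: "('a \<Rightarrow> nat) \<Rightarrow> 'a set \<Rightarrow> bool" where
  "monochrome f \<sigma> \<longleftrightarrow> (\<exists>c. \<forall>v\<in>\<sigma>. f v = c)"

text \<open>Colorings are taken as extensional functions on the vertex set, so that they can be counted.\<close>

definition colorings :: "nat \<Rightarrow> nat \<Rightarrow> 'a set set \<Rightarrow> ('a \<Rightarrow> nat) set" where
  "colorings r s K = {f \<in> vertices K \<rightarrow>\<^sub>E {1..r}. \<not> (\<exists>\<sigma>\<in>simplices s K. monochrome f \<sigma>)}"

definition num_colorings :: "nat \<Rightarrow> 'a set set \<Rightarrow> nat \<Rightarrow> nat" where
  "num_colorings s K r = card (colorings r s K)"

definition connectedness :: "'a set set \<Rightarrow> ('a set \<times> 'a set) set" where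
  "connectedness S = \<Inter>{R. equiv S R \<and> (\<forall>\<sigma>\<in>S. \<forall>\<tau>\<in>S. \<sigma> \<inter> \<tau> \<noteq> {} \<longrightarrow> (\<sigma>, \<tau>) \<in> R)}"

definition conn_components :: "'a set set \<Rightarrow> 'a set set set" where
  "conn_components S = S // connectedness S"

definition closed_simplices :: "nat \<Rightarrow> 'a set set \<Rightarrow> 'a set set \<Rightarrow> bool" where
  "closed_simplices s K S \<longleftrightarrow> {\<sigma> \<in> simplices s K. \<sigma> \<subseteq> vertices S} = S"

definition block_partition :: "'a set set \<Rightarrow> 'a set set \<Rightarrow> 'a set set" where
  "block_partition K S = vertices ` conn_components S \<union> {{v} |v. v \<in> vertices K - vertices S}"

definition chromatic_lattice :: "nat \<Rightarrow> 'a set set \<Rightarrow> 'a set set set" where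
  "chromatic_lattice s K =
     {S. S \<subseteq> simplices s K \<and> (\<forall>C\<in>conn_components S. closed_simplices s K C)}"

text \<open>The Moebius function of a locally finite poset \<open>P\<close> with the order of the ambient type,
  extended by \<open>0\<close>; for \<open>x < y\<close> the recursion says that \<open>mobius P x z\<close> sums to \<open>0\<close> over
  the interval from \<open>x\<close> to \<open>y\<close> in \<open>P\<close>.\<close>

function mobius :: "'b::order set \<Rightarrow> 'b \<Rightarrow> 'b \<Rightarrow> int" where
  "mobius P x y =
     (if x \<in> P \<and> y \<in> P \<and> x \<le> y \<and> finite {z \<in> P. x \<le> z \<and> z \<le> y}
      then if x = y then 1 else - (\<Sum>z \<in> {z \<in> P. x \<le> z \<and> z < y}. mobius P x z)
      else 0)"
  by pat_completeness auto

termination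
proof (relation "measure (\<lambda>(P, x, y). card {z \<in> P. x \<le> z \<and> z \<le> y})")
  show "wf (measure (\<lambda>(P, x, y). card {z \<in> P. x \<le> z \<and> z \<le> y}))"
    by simp
next
  fix P and x y z :: "'b::order"
  assume a: "x \<in> P \<and> y \<in> P \<and> x \<le> y \<and> finite {z \<in> P. x \<le> z \<and> z \<le> y}"
    and z: "z \<in> {z \<in> P. x \<le> z \<and> z < y}"
  have "{w \<in> P. x \<le> w \<and> w \<le> z} \<subseteq> {w \<in> P. x \<le> w \<and> w \<le> y}"
    using z by auto
  moreover have "y \<in> {w \<in> P. x \<le> w \<and> w \<le> y}" "y \<notin> {w \<in> P. x \<le> w \<and> w \<le> z}"
    using a z by auto
  ultimately have "{w \<in> P. x \<le> w \<and> w \<le> z} \<subset> {w \<in> P. x \<le> w \<and> w \<le> y}"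
    by blast
  then show "((P, x, z), (P, x, y)) \<in> measure (\<lambda>(P, x, y). card {z \<in> P. x \<le> z \<and> z \<le> y})"
    using a by (simp add: psubset_card_mono)
qed

declare mobius.simps [simp del]

end

theory Submission
  imports Defs "HOL-Library.Disjoint_Sets"
begin

text \<open>The set of monochrome simplices of an arbitrary map from the vertices to the colors is an
  element of the lattice, since connected monochrome simplices share their color; the map is a
  coloring iff this set is empty. For \<open>T\<close> in the lattice there are \<open>r\<^bsup>|\<pi>(T)|\<^esup>\<close> maps for which all
  simplices of \<open>T\<close> are monochrome, namely those constant on the blocks of \<open>\<pi>(T)\<close>. This number is
  the sum, over all \<open>U\<close> above \<open>T\<close>, of the number of maps whose set of monochrome simplices is
  exactly \<open>U\<close>, and Moebius inversion recovers the term \<open>U = \<emptyset>\<close>.\<close>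

lemma sum_mobius_interval:
  assumes "x \<in> P" "y \<in> P" "finite {z \<in> P. x \<le> z \<and> z \<le> y}"
  shows "(\<Sum>z | z \<in> P \<and> x \<le> z \<and> z \<le> y. mobius P x z) = of_bool (x = y)"
proof (cases "x \<le> y")
  case False
  then have no_interval: "{z \<in> P. x \<le> z \<and> z \<le> y} = {}"
    by (auto dest: order_trans)
  show ?thesis
    unfolding no_interval using False by auto
next
  case True
  have interval: "{z \<in> P. x \<le> z \<and> z \<le> y} = insert y {z \<in> P. x \<le> z \<and> z < y}"
    using assms(2) True by auto
  then have "finite {z \<in> P. x \<le> z \<and> z < y}"
    using assms(3) by simp
  then have "(\<Sum>z | z \<in> P \<and> x \<le> z \<and> z \<le> y. mobius P x z)
      = mobius P x y + (\<Sum>z | z \<in> P \<and> x \<le> z \<and> z < y. mobius P x z)"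
    unfolding interval by simp
  moreover have "mobius P x y
      = (if x = y then 1 else - (\<Sum>z | z \<in> P \<and> x \<le> z \<and> z < y. mobius P x z))"
    using assms True by (subst mobius.simps) simp
  moreover have "(\<Sum>z | z \<in> P \<and> x \<le> z \<and> z < y. mobius P x z) = 0" if "x = y"
    using that by (intro sum.neutral) auto
  ultimately show ?thesis by auto
qed

lemma mobius_inversion_above:
  fixes g h :: "'b::order \<Rightarrow> 'c::ring_1"
  assumes x: "x \<in> P" and fin: "finite {y \<in> P. x \<le> y}"
    and h: "\<And>y. y \<in> P \<Longrightarrow> x \<le> y \<Longrightarrow> h y = (\<Sum>z | z \<in> P \<and> y \<le> z. g z)"
  shows "g x = (\<Sum>y | y \<in> P \<and> x \<le> y. of_int (mobius P x y) * h y)"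
proof -
  define above where "above = {y \<in> P. x \<le> y}"
  have interval_sum: "(\<Sum>y | y \<in> above \<and> y \<le> z. mobius P x y) = of_bool (x = z)"
    if "z \<in> above" for z
  proof -
    have "finite {y \<in> P. x \<le> y \<and> y \<le> z}"
      by (rule finite_subset[OF _ fin]) auto
    then show ?thesis
      using sum_mobius_interval[OF x, of z] that by (simp add: above_def conj_assoc)
  qed
  have "(\<Sum>y\<in>above. of_int (mobius P x y) * h y)
      = (\<Sum>y\<in>above. \<Sum>z | z \<in> above \<and> y \<le> z. of_int (mobius P x y) * g z)"
  proof (rule sum.cong[OF refl])
    fix y assume "y \<in> above"
    then have "{z \<in> P. y \<le> z} = {z \<in> above. y \<le> z}"
      by (auto simp: above_def)
    then show "of_int (mobius P x y) * h y
        = (\<Sum>z | z \<in> above \<and> y \<le> z. of_int (mobius P x y) * g z)"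
      using h \<open>y \<in> above\<close> by (simp add: above_def sum_distrib_left)
  qed
  also have "\<dots> = (\<Sum>z\<in>above. \<Sum>y | y \<in> above \<and> y \<le> z. of_int (mobius P x y) * g z)"
    using fin unfolding above_def by (intro sum.swap_restrict)
  also have "\<dots> = (\<Sum>z\<in>above. of_int (\<Sum>y | y \<in> above \<and> y \<le> z. mobius P x y) * g z)"
    by (simp add: sum_distrib_right)
  also have "\<dots> = (\<Sum>z\<in>above. if x = z then g z else 0)"
    using interval_sum by (intro sum.cong) auto
  also have "\<dots> = g x"
    using x fin by (simp add: above_def)
  finally show ?thesis by (simp add: above_def)
qed

lemma card_eq_sum_card_fibres_above:
  fixes M :: "'a \<Rightarrow> 'b::preorder"
  assumes "finite F" "finite P" "M ` F \<subseteq> P"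
  shows "card {f \<in> F. x \<le> M f} = (\<Sum>y | y \<in> P \<and> x \<le> y. card {f \<in> F. M f = y})"
proof -
  have "(\<Sum>y | y \<in> P \<and> x \<le> y. card {f \<in> F. M f = y})
      = (\<Sum>y | y \<in> P \<and> x \<le> y. \<Sum>f | f \<in> {f \<in> F. x \<le> M f} \<and> M f = y. 1)"
    by (intro sum.cong) (auto intro: arg_cong[where f = card])
  also have "\<dots> = (\<Sum>f | f \<in> F \<and> x \<le> M f. 1)"
    using assms by (intro sum.group) auto
  finally show ?thesis by simp
qed

lemma bij_betw_quotient_funcset:
  assumes r: "equiv A r"
  shows "bij_betw (\<lambda>g. \<lambda>x\<in>A. g (r `` {x})) (A // r \<rightarrow>\<^sub>E B) {f \<in> A \<rightarrow>\<^sub>E B. f respects r}"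
    (is "bij_betw ?lift _ _")
proof (rule bij_betw_imageI)
  show "inj_on ?lift (A // r \<rightarrow>\<^sub>E B)"
  proof (rule inj_onI)
    fix g h assume gh: "g \<in> A // r \<rightarrow>\<^sub>E B" "h \<in> A // r \<rightarrow>\<^sub>E B" "?lift g = ?lift h"
    have "g X = h X" if "X \<in> A // r" for X
      using that
    proof (rule quotientE)
      fix x assume "X = r `` {x}" "x \<in> A"
      with fun_cong[OF gh(3), of x] show ?thesis by simp
    qed
    with gh(1,2) show "g = h" by (rule PiE_ext)
  qed
next
  have lift_respects: "?lift g respects r" for g
    using equiv_class_eq[OF r] equiv_type[OF r] by (auto intro!: congruentI)
  have "f \<in> ?lift ` (A // r \<rightarrow>\<^sub>E B)" if f: "f \<in> A \<rightarrow>\<^sub>E B" "f respects r" for f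
  proof -
    have the_elem_class: "the_elem (f ` (r `` {x})) = f x" if "x \<in> A" for x
    proof (rule the_elem_image_unique)
      show "r `` {x} \<noteq> {}"
        using equiv_class_self[OF r that] by blast
      show "f y = f x" if "y \<in> r `` {x}" for y
        using that congruentD[OF f(2), of x y] by simp
    qed
    define g where "g = (\<lambda>X\<in>A // r. the_elem (f ` X))"
    have "g \<in> A // r \<rightarrow>\<^sub>E B"
      using the_elem_class f(1) by (auto simp: g_def elim!: quotientE)
    moreover have "?lift g = f"
      using the_elem_class f(1) by (intro PiE_ext[of _ A "\<lambda>_. B"]) (auto simp: g_def quotientI)
    ultimately show ?thesis by blast
  qed
  then show "?lift ` (A // r \<rightarrow>\<^sub>E B) = {f \<in> A \<rightarrow>\<^sub>E B. f respects r}"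
    using lift_respects by (auto simp: quotientI PiE_mem)
qed

lemma card_funcset_respecting:
  assumes "equiv A r" "finite (A // r)"
  shows "card {f \<in> A \<rightarrow>\<^sub>E B. f respects r} = card B ^ card (A // r)"
  using bij_betw_same_card[OF bij_betw_quotient_funcset[OF assms(1), of B]]
    card_funcsetE[OF assms(2), of B] by simp

lemma card_funcset_constant_on_parts:
  assumes P: "partition_on A P" and fin: "finite P"
  shows "card {f \<in> A \<rightarrow>\<^sub>E B. \<forall>p\<in>P. \<forall>x\<in>p. \<forall>y\<in>p. f x = f y} = card B ^ card P"
proof -
  define r where "r = {(x, y). \<exists>p\<in>P. x \<in> p \<and> y \<in> p}"
  have "equiv A r" "A // r = P"
    unfolding r_def using P by (rule equiv_partition_on, rule partition_on_eq_quotient)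
  moreover have "f respects r \<longleftrightarrow> (\<forall>p\<in>P. \<forall>x\<in>p. \<forall>y\<in>p. f x = f y)" for f :: "'a \<Rightarrow> 'b"
    unfolding congruent_def r_def by auto
  ultimately show ?thesis
    using card_funcset_respecting[of A r B] fin by simp
qed

lemma partition_on_Un:
  assumes "partition_on A P" "partition_on B Q" "A \<inter> B = {}"
  shows "partition_on (A \<union> B) (P \<union> Q)"
  using assms by (auto simp: partition_on_def intro: disjoint_union)

lemma equiv_connectedness: "equiv S (connectedness S)"
proof -
  have "equiv S (S \<times> S)"
    by (auto simp: equiv_def refl_on_def sym_def trans_def)
  then have "connectedness S \<subseteq> S \<times> S"
    unfolding connectedness_def by blast
  moreover have "refl_on S (connectedness S)"
    by (auto simp: connectedness_def refl_on_def equiv_def)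
  moreover have "sym (connectedness S)"
    unfolding connectedness_def by (rule symI) (auto simp: equiv_def dest: symD)
  moreover have "trans (connectedness S)"
    unfolding connectedness_def by (rule transI) (auto simp: equiv_def dest: transD)
  ultimately show ?thesis by (rule equivI)
qed

lemma connectedness_intersecting:
  "\<sigma> \<in> S \<Longrightarrow> \<tau> \<in> S \<Longrightarrow> \<sigma> \<inter> \<tau> \<noteq> {} \<Longrightarrow> (\<sigma>, \<tau>) \<in> connectedness S"
  by (auto simp: connectedness_def)

lemma connectedness_least:
  assumes "equiv S R" "\<And>\<sigma> \<tau>. \<sigma> \<in> S \<Longrightarrow> \<tau> \<in> S \<Longrightarrow> \<sigma> \<inter> \<tau> \<noteq> {} \<Longrightarrow> (\<sigma>, \<tau>) \<in> R"
  shows "connectedness S \<subseteq> R"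
  using assms by (auto simp: connectedness_def)

lemma partition_on_conn_components: "partition_on S (conn_components S)"
  unfolding conn_components_def by (rule partition_on_quotient[OF equiv_connectedness])

lemma Union_conn_components: "\<Union>(conn_components S) = S"
  by (rule partition_onD1[OF partition_on_conn_components, symmetric])

lemma conn_component_subset: "C \<in> conn_components S \<Longrightarrow> C \<subseteq> S"
  using Union_conn_components by blast

lemma conn_components_eqI:
  assumes "C \<in> conn_components S" "D \<in> conn_components S"
    and "\<sigma> \<in> C" "\<tau> \<in> D" "\<sigma> \<inter> \<tau> \<noteq> {}"
  shows "C = D"
proof -
  have "(\<sigma>, \<tau>) \<in> connectedness S"
    using assms conn_component_subset by (blast intro: connectedness_intersecting)
  then show ?thesis
    using quotient_eqI[OF equiv_connectedness] assms(1-4) unfolding conn_components_def by blast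
qed

lemma partition_on_vertices_conn_components:
  assumes "{} \<notin> S"
  shows "partition_on (vertices S) (vertices ` conn_components S)"
proof (rule partition_onI)
  show "\<Union>(vertices ` conn_components S) = vertices S"
    using Union_conn_components[of S] by (auto simp: vertices_def)
next
  fix p q
  assume "p \<in> vertices ` conn_components S" "q \<in> vertices ` conn_components S" "p \<noteq> q"
  then obtain C D where CD: "C \<in> conn_components S" "D \<in> conn_components S" "C \<noteq> D"
    and pq: "p = vertices C" "q = vertices D"
    by blast
  have "\<sigma> \<inter> \<tau> = {}" if "\<sigma> \<in> C" "\<tau> \<in> D" for \<sigma> \<tau>
    using conn_components_eqI[OF CD(1,2) that] CD(3) by blast
  then show "disjnt p q"
    unfolding pq vertices_def disjnt_def by blast
next
  have "vertices C \<noteq> {}" if "C \<in> conn_components S" for C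
  proof -
    have "C \<noteq> {}"
      using that partition_onD3[OF partition_on_conn_components] by blast
    moreover have "{} \<notin> C"
      using that assms conn_component_subset by blast
    ultimately show ?thesis
      unfolding vertices_def by auto
  qed
  then show "{} \<notin> vertices ` conn_components S" by auto
qed

lemma partition_on_block_partition:
  assumes "vertices S \<subseteq> vertices K" "{} \<notin> S"
  shows "partition_on (vertices K) (block_partition K S)"
proof -
  have "partition_on (vertices S \<union> (vertices K - vertices S))
      (vertices ` conn_components S \<union> (\<lambda>v. {v}) ` (vertices K - vertices S))"
    using partition_on_vertices_conn_components[OF assms(2)] partition_on_singletons
    by (rule partition_on_Un) blast
  moreover have "vertices S \<union> (vertices K - vertices S) = vertices K"
    using assms(1) by blast
  ultimately show ?thesis
    by (simp only: block_partition_def Setcompr_eq_image)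
qed

lemma monochrome_iff: "monochrome f \<sigma> \<longleftrightarrow> (\<forall>x\<in>\<sigma>. \<forall>y\<in>\<sigma>. f x = f y)"
  unfolding monochrome_def by metis

lemma monochrome_subset: "monochrome f \<tau> \<Longrightarrow> \<sigma> \<subseteq> \<tau> \<Longrightarrow> monochrome f \<sigma>"
  unfolding monochrome_def by blast

lemma monochrome_vertices_conn_component:
  assumes mono: "\<And>\<sigma>. \<sigma> \<in> S \<Longrightarrow> monochrome f \<sigma>" and C: "C \<in> conn_components S"
  shows "monochrome f (vertices C)"
proof -
  have same_colors: "connectedness S \<subseteq> {(\<sigma>, \<tau>) \<in> S \<times> S. f ` \<sigma> = f ` \<tau>}"
  proof (rule connectedness_least)
    show "equiv S {(\<sigma>, \<tau>) \<in> S \<times> S. f ` \<sigma> = f ` \<tau>}"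
      by (auto simp: equiv_def refl_on_def sym_def trans_def)
  next
    fix \<sigma> \<tau> assume \<sigma>\<tau>: "\<sigma> \<in> S" "\<tau> \<in> S" "\<sigma> \<inter> \<tau> \<noteq> {}"
    then obtain v where "v \<in> \<sigma>" "v \<in> \<tau>" by blast
    then have "f ` \<sigma> = {f v}" "f ` \<tau> = {f v}"
      using mono[OF \<sigma>\<tau>(1)] mono[OF \<sigma>\<tau>(2)] unfolding monochrome_def by auto
    then show "(\<sigma>, \<tau>) \<in> {(\<sigma>, \<tau>) \<in> S \<times> S. f ` \<sigma> = f ` \<tau>}"
      using \<sigma>\<tau> by simp
  qed
  have "f x = f y" if "\<sigma> \<in> C" "x \<in> \<sigma>" "\<tau> \<in> C" "y \<in> \<tau>" for \<sigma> \<tau> x y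
  proof -
    have "(\<sigma>, \<tau>) \<in> connectedness S"
      using that C in_quotient_imp_in_rel[OF equiv_connectedness, of C S \<sigma> \<tau>]
      by (simp add: conn_components_def)
    then obtain z where "z \<in> \<tau>" "f x = f z"
      using same_colors \<open>x \<in> \<sigma>\<close> by blast
    moreover have "monochrome f \<tau>"
      using \<open>\<tau> \<in> C\<close> C conn_component_subset mono by blast
    ultimately show ?thesis
      using \<open>y \<in> \<tau>\<close> unfolding monochrome_def by auto
  qed
  then show ?thesis
    unfolding monochrome_iff vertices_def by (intro ballI) (elim UnionE)
qed

lemma all_monochrome_iff_blocks_monochrome:
  "(\<forall>\<sigma>\<in>S. monochrome f \<sigma>) \<longleftrightarrow> (\<forall>p\<in>block_partition K S. monochrome f p)"
proof
  assume "\<forall>\<sigma>\<in>S. monochrome f \<sigma>"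
  then show "\<forall>p\<in>block_partition K S. monochrome f p"
    using monochrome_vertices_conn_component[of S f]
    by (auto simp: block_partition_def monochrome_iff[of f "{_}"])
next
  assume blocks: "\<forall>p\<in>block_partition K S. monochrome f p"
  show "\<forall>\<sigma>\<in>S. monochrome f \<sigma>"
  proof
    fix \<sigma> assume "\<sigma> \<in> S"
    then obtain C where C: "C \<in> conn_components S" "\<sigma> \<in> C"
      using Union_conn_components by blast
    then have "monochrome f (vertices C)"
      using blocks by (simp add: block_partition_def)
    moreover have "\<sigma> \<subseteq> vertices C"
      using C(2) by (auto simp: vertices_def)
    ultimately show "monochrome f \<sigma>" by (rule monochrome_subset)
  qed
qed

lemma card_funcset_all_monochrome:
  assumes "finite (vertices K)" "vertices S \<subseteq> vertices K" "{} \<notin> S"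
  shows "card {f \<in> vertices K \<rightarrow>\<^sub>E B. \<forall>\<sigma>\<in>S. monochrome f \<sigma>} = card B ^ card (block_partition K S)"
proof -
  have partition: "partition_on (vertices K) (block_partition K S)"
    using assms(2,3) by (rule partition_on_block_partition)
  then have "finite (block_partition K S)"
    using assms(1) by (rule finite_elements[rotated])
  with partition show ?thesis
    unfolding all_monochrome_iff_blocks_monochrome[of S _ K] unfolding monochrome_iff
    by (rule card_funcset_constant_on_parts)
qed

lemma finite_vertices: "simplicial_complex K \<Longrightarrow> finite K \<Longrightarrow> finite (vertices K)"
  unfolding vertices_def simplicial_complex_def by blast

lemma empty_notin_simplices: "{} \<notin> simplices s K"
  by (simp add: simplices_def)

lemma chromatic_lattice_subset: "chromatic_lattice s K \<subseteq> Pow (simplices s K)"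
  unfolding chromatic_lattice_def by blast

lemma finite_chromatic_lattice: "finite K \<Longrightarrow> finite (chromatic_lattice s K)"
  by (rule finite_subset[OF chromatic_lattice_subset]) (simp add: simplices_def)

lemma empty_in_chromatic_lattice: "{} \<in> chromatic_lattice s K"
  by (simp add: chromatic_lattice_def conn_components_def)

lemma closed_conn_componentI:
  assumes S: "S \<subseteq> simplices s K" and C: "C \<in> conn_components S"
    and closed: "\<And>\<sigma>. \<sigma> \<in> simplices s K \<Longrightarrow> \<sigma> \<subseteq> vertices C \<Longrightarrow> \<sigma> \<in> S"
  shows "closed_simplices s K C"
  unfolding closed_simplices_def
proof (intro equalityI subsetI)
  fix \<sigma> assume "\<sigma> \<in> {\<sigma> \<in> simplices s K. \<sigma> \<subseteq> vertices C}"
  then have \<sigma>: "\<sigma> \<in> simplices s K" "\<sigma> \<subseteq> vertices C" by auto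
  then have "\<sigma> \<in> S" by (rule closed)
  then obtain D where D: "D \<in> conn_components S" "\<sigma> \<in> D"
    using Union_conn_components by blast
  have "\<sigma> \<noteq> {}"
    using \<sigma>(1) empty_notin_simplices by blast
  then obtain \<tau> where "\<tau> \<in> C" "\<tau> \<inter> \<sigma> \<noteq> {}"
    using \<sigma>(2) unfolding vertices_def by blast
  then have "C = D"
    using conn_components_eqI[OF C D(1) _ D(2)] by blast
  with D(2) show "\<sigma> \<in> C" by simp
next
  fix \<sigma> assume "\<sigma> \<in> C"
  then show "\<sigma> \<in> {\<sigma> \<in> simplices s K. \<sigma> \<subseteq> vertices C}"
    using S conn_component_subset[OF C] by (auto simp: vertices_def)
qed

definition monochrome_simplices :: "nat \<Rightarrow> 'a set set \<Rightarrow> ('a \<Rightarrow> nat) \<Rightarrow> 'a set set" where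
  "monochrome_simplices s K f = {\<sigma> \<in> simplices s K. monochrome f \<sigma>}"

lemma monochrome_simplices_in_chromatic_lattice:
  "monochrome_simplices s K f \<in> chromatic_lattice s K"
proof -
  have simplices: "monochrome_simplices s K f \<subseteq> simplices s K"
    by (auto simp: monochrome_simplices_def)
  have "closed_simplices s K C" if C: "C \<in> conn_components (monochrome_simplices s K f)" for C
    using simplices C
  proof (rule closed_conn_componentI)
    have "monochrome f (vertices C)"
      using C
      by (rule monochrome_vertices_conn_component[rotated]) (simp add: monochrome_simplices_def)
    then show "\<sigma> \<in> monochrome_simplices s K f" if "\<sigma> \<in> simplices s K" "\<sigma> \<subseteq> vertices C" for \<sigma>
      using that by (simp add: monochrome_simplices_def monochrome_subset)
  qed
  with simplices show ?thesis
    by (simp add: chromatic_lattice_def)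
qed

lemma colorings_eq_no_monochrome_simplices:
  "colorings r s K = {f \<in> vertices K \<rightarrow>\<^sub>E {1..r}. monochrome_simplices s K f = {}}"
  by (auto simp: colorings_def monochrome_simplices_def)

lemma card_maps_monochrome_simplices_above:
  assumes "finite (vertices K)" "T \<subseteq> simplices s K"
  shows "card {f \<in> vertices K \<rightarrow>\<^sub>E {1..r}. T \<subseteq> monochrome_simplices s K f}
    = r ^ card (block_partition K T)"
proof -
  have "T \<subseteq> monochrome_simplices s K f \<longleftrightarrow> (\<forall>\<sigma>\<in>T. monochrome f \<sigma>)" for f
    using assms(2) by (auto simp: monochrome_simplices_def)
  moreover have "vertices T \<subseteq> vertices K" "{} \<notin> T"
    using assms(2) by (auto simp: vertices_def simplices_def)
  ultimately show ?thesis
    using card_funcset_all_monochrome[OF assms(1), of T "{1..r}"] by simp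
qed

theorem theorem2p24:
  fixes K :: "'a set set" and s r :: nat
  assumes "simplicial_complex K" and "finite K" and "vertices K \<noteq> {}"
    and "s \<ge> 1" and "r \<ge> 1"
  shows "int (num_colorings s K r) =
    (\<Sum>T \<in> chromatic_lattice s K.
       mobius (chromatic_lattice s K) {} T * int r ^ card (block_partition K T))"
proof -
  let ?L = "chromatic_lattice s K" and ?maps = "vertices K \<rightarrow>\<^sub>E {1..r}"
  let ?exactly = "\<lambda>U. card {f \<in> ?maps. monochrome_simplices s K f = U}"
  have fin: "finite (vertices K)" "finite ?L"
    using assms(1,2) by (simp_all add: finite_vertices finite_chromatic_lattice)
  have "r ^ card (block_partition K T) = (\<Sum>U | U \<in> ?L \<and> T \<subseteq> U. ?exactly U)" if "T \<in> ?L" for T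
  proof -
    have "r ^ card (block_partition K T) = card {f \<in> ?maps. T \<subseteq> monochrome_simplices s K f}"
      using that chromatic_lattice_subset fin(1)
      by (intro card_maps_monochrome_simplices_above[symmetric]) auto
    also have "\<dots> = (\<Sum>U | U \<in> ?L \<and> T \<subseteq> U. ?exactly U)"
      using fin monochrome_simplices_in_chromatic_lattice
      by (intro card_eq_sum_card_fibres_above) (auto intro: finite_PiE)
    finally show ?thesis .
  qed
  then have "int (?exactly {}) = (\<Sum>T | T \<in> ?L \<and> {} \<subseteq> T.
      of_int (mobius ?L {} T) * int (r ^ card (block_partition K T)))"
    using fin by (intro mobius_inversion_above) (simp_all add: empty_in_chromatic_lattice)
  then show ?thesis
    by (simp add: num_colorings_def colorings_eq_no_monochrome_simplices)
qed

end
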